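(* Let $\mathfrak{A}$ be a unital JB$^*$-algebra, and let $f\colon\mathfrak{A}\to\mathbb{C}$ be a (not necessarily linear) functional satisfying: (a) $f$ is continuous; (b) $f(U_x(y))=U_{f(x)}f(y)$, i.e. $f(U_x(y))=f(x)^2f(y)$, for all $x,y\in\mathfrak{A}$; (c) $f(x)\in\text{J-}\sigma(x)$ for each $x\in\mathfrak{A}$. Then $f$ is a linear (Jordan-)multiplicative functional on $\mathfrak{A}$, i.e. $f$ is complex-linear and $f(x\circ y)=f(x)f(y)$ for all $x,y\in\mathfrak{A}$.
   Context: A complex Jordan--Banach algebra is a complex Banach space $\mathfrak{A}$ with a bilinear product $(a,b)\mapsto a\circ b$ satisfying $\|a\circ b\|\le\|a\|\,\|b\|$, $a\circ b=b\circ a$, and $(a^2\circ b)\circ a=(a\circ b)\circ a^2$ for all $a,b$ (where $a^2=a\circ a$). It is unital if there is $\mathbf{1}\in\mathfrak{A}$ with $\mathbf{1}\circ a=a$ for all $a$. For $a\in\mathfrak{A}$, $U_a\colon\mathfrak{A}\to\mathfrak{A}$ is the linear map $U_a(b)=2(a\circ b)\circ a-a^2\circ b$; in $\mathbb{C}$ this reads $U_\alpha(\beta)=\alpha^2\beta$. A JB$^*$-algebra is a complex Jordan--Banach algebra $\mathfrak{A}$ equipped with an algebra involution $a\mapsto a^*$ (conjugate-linear, $a^{**}=a$, $(a\circ b)^*=a^*\circ b^*$) satisfying $\|U_a(a^* )\|=\|a\|^3$ for all $a\in\mathfrak{A}$. An element $a$ is invertible if there is $b\in\mathfrak{A}$ with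 $a\circ b=\mathbf{1}$ and $a^2\circ b=a$. The (Jordan-)spectrum of $a$ is $\text{J-}\sigma(a)=\{\lambda\in\mathbb{C}: a-\lambda\mathbf{1}\text{ is not invertible}\}$. *)

theory Defs
  imports "HOL-Analysis.Analysis"
begin

text \<open>
  The library has no complex normed spaces. A complex Banach space is a real Banach space
  (class \<open>banach\<close>) together with a complex scalar multiplication that extends the real one and
  for which the norm is homogeneous.
\<close>

locale complex_banach_space = vector_space scaleC
  for scaleC :: "complex \<Rightarrow> 'a::banach \<Rightarrow> 'a" (infixr \<open>*\<^sub>C\<close> 75) +
  assumes scaleC_of_real: "complex_of_real r *\<^sub>C x = r *\<^sub>R x"
    and norm_scaleC: "norm (c *\<^sub>C x) = cmod c * norm x"

locale jordan_banach_algebra = complex_banach_space scaleC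
  for scaleC :: "complex \<Rightarrow> 'a::banach \<Rightarrow> 'a" (infixr \<open>*\<^sub>C\<close> 75) +
  fixes circ :: "'a \<Rightarrow> 'a \<Rightarrow> 'a" (infixl \<open>\<odot>\<close> 70)
  assumes linear_left: "Vector_Spaces.linear scaleC scaleC (\<lambda>a. a \<odot> b)"
    and linear_right: "Vector_Spaces.linear scaleC scaleC (\<lambda>b. a \<odot> b)"
    and norm_circ_le: "norm (a \<odot> b) \<le> norm a * norm b"
    and circ_commute: "a \<odot> b = b \<odot> a"
    and jordan_identity: "((a \<odot> a) \<odot> b) \<odot> a = (a \<odot> b) \<odot> (a \<odot> a)"

definition jordan_U :: "('a::real_vector \<Rightarrow> 'a \<Rightarrow> 'a) \<Rightarrow> 'a \<Rightarrow> 'a \<Rightarrow> 'a" where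
  "jordan_U circ a b = 2 *\<^sub>R circ (circ a b) a - circ (circ a a) b"

lemma jordan_U_complex: "jordan_U (*) \<alpha> \<beta> = \<alpha>\<^sup>2 * (\<beta> :: complex)"
  by (simp add: jordan_U_def scaleR_conv_of_real power2_eq_square algebra_simps)

locale jb_star_algebra = jordan_banach_algebra scaleC circ
  for scaleC :: "complex \<Rightarrow> 'a::banach \<Rightarrow> 'a" (infixr \<open>*\<^sub>C\<close> 75)
    and circ :: "'a \<Rightarrow> 'a \<Rightarrow> 'a" (infixl \<open>\<odot>\<close> 70) +
  fixes star :: "'a \<Rightarrow> 'a"
  assumes star_add: "star (a + b) = star a + star b"
    and star_scaleC: "star (c *\<^sub>C a) = cnj c *\<^sub>C star a"
    and star_star: "star (star a) = a"
    and star_circ: "star (a \<odot> b) = star a \<odot> star b"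
    and norm_jordan_U_star: "norm (jordan_U circ a (star a)) = norm a ^ 3"

locale unital_jb_star_algebra = jb_star_algebra scaleC circ star
  for scaleC :: "complex \<Rightarrow> 'a::banach \<Rightarrow> 'a" (infixr \<open>*\<^sub>C\<close> 75)
    and circ :: "'a \<Rightarrow> 'a \<Rightarrow> 'a" (infixl \<open>\<odot>\<close> 70)
    and star :: "'a \<Rightarrow> 'a" +
  fixes unit :: 'a
  assumes unit_circ: "unit \<odot> a = a"

definition jordan_invertible :: "('a \<Rightarrow> 'a \<Rightarrow> 'a) \<Rightarrow> 'a \<Rightarrow> 'a \<Rightarrow> bool" where
  "jordan_invertible circ unit a \<longleftrightarrow> (\<exists>b. circ a b = unit \<and> circ (circ a a) b = a)"

definition jordan_spectrum ::
  "(complex \<Rightarrow> 'a::ab_group_add \<Rightarrow> 'a) \<Rightarrow> ('a \<Rightarrow> 'a \<Rightarrow> 'a) \<Rightarrow> 'a \<Rightarrow> 'a \<Rightarrow> complex set" where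
  "jordan_spectrum scaleC circ unit a =
     {z. \<not> jordan_invertible circ unit (a - scaleC z unit)}"

lemma unital_jb_star_algebra_complex: "unital_jb_star_algebra (*) (*) cnj (1 :: complex)"
  by unfold_locales
    (simp_all add: algebra_simps scaleR_conv_of_real norm_mult jordan_U_complex
       norm_power power2_eq_square power3_eq_cube)

end

theory Submission
  imports Defs "HOL-Complex_Analysis.Complex_Analysis"
begin

text \<open>
  A self-adjoint \<open>c\<close> with \<open>\<parallel>c\<parallel> \<le> 1/2\<close> is the real part of a unitary, which together with
  \<open>\<parallel>b\<^sup>3\<parallel> = \<parallel>b\<parallel>\<^sup>3\<close> for self-adjoint \<open>b\<close> bounds \<open>\<parallel>p(c)\<parallel>\<close> by the supremum of \<open>|p|\<close> on \<open>[-1, 1]\<close>.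
  This gives a continuous functional calculus \<open>\<Phi>\<close>, and \<open>F = f \<circ> \<Phi>\<close> satisfies
  \<open>F(g\<^sup>2 h) = F(g)\<^sup>2 F(h)\<close> and \<open>F(g) \<in> g[-1, 1]\<close>. On exponentials \<open>F\<close> is given by an additive
  functional \<open>\<psi>\<close> with \<open>\<psi>(g) \<in> g[-1, 1]\<close>; applied to \<open>k + \<i>l\<close> this makes \<open>\<psi>\<close> on real functions, and
  hence \<open>F\<close> on nonnegative ones, the evaluation at a point \<open>\<alpha>\<close>.

  If \<open>h\<close> is a narrow bump at \<open>\<alpha>\<close> evaluated at \<open>c\<close>, then \<open>f(h) = 1\<close>, so \<open>f(x) = f(U\<^sub>h x)\<close> for all
  \<open>x\<close>, while \<open>U\<^sub>h\<close> does not distinguish \<open>c\<close> from an element arbitrarily close to \<open>\<alpha>1\<close>. Continuity of \<open>f\<close>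
  yields \<open>f(y + c) = f(y + \<alpha>1)\<close> for all \<open>y\<close>. Splitting into self-adjoint parts, every \<open>x\<close> may thus be
  replaced by a scalar inside \<open>f(y + x)\<close>, which makes \<open>f\<close> additive; multiplicativity follows from
  \<open>f(x\<^sup>2) = f(x)\<^sup>2\<close> by polarization.
\<close>

section \<open>Bilinearity and the linearized Jordan identity\<close>

sublocale complex_banach_space \<subseteq> scaleC: bounded_bilinear scaleC
proof
  show "\<exists>K. \<forall>a b. norm (a *\<^sub>C b) \<le> norm a * norm b * K"
    by (rule exI[of _ 1]) (simp add: norm_scaleC)
  fix r :: real and z :: complex and x :: 'a
  show "(r *\<^sub>R z) *\<^sub>C x = r *\<^sub>R z *\<^sub>C x" "z *\<^sub>C r *\<^sub>R x = r *\<^sub>R z *\<^sub>C x"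
    by (simp_all add: scaleC_of_real[symmetric] scaleR_conv_of_real mult.commute)
qed (simp_all add: scale_left_distrib scale_right_distrib)

context jordan_banach_algebra
begin

lemma circ_scaleC_left: "(z *\<^sub>C a) \<odot> b = z *\<^sub>C (a \<odot> b)"
  using module_hom.scale[OF Vector_Spaces.linear.axioms(3)[OF linear_left]] .

lemma circ_scaleC_right: "a \<odot> (z *\<^sub>C b) = z *\<^sub>C (a \<odot> b)"
  using circ_scaleC_left circ_commute by metis

sublocale circ: bounded_bilinear circ
proof
  fix a a' b b' :: 'a and r :: real
  show "(a + a') \<odot> b = a \<odot> b + a' \<odot> b"
    using module_hom.add[OF Vector_Spaces.linear.axioms(3)[OF linear_left]] .
  show "a \<odot> (b + b') = a \<odot> b + a \<odot> b'"
    using module_hom.add[OF Vector_Spaces.linear.axioms(3)[OF linear_right]] .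
  show "(r *\<^sub>R a) \<odot> b = r *\<^sub>R (a \<odot> b)" "a \<odot> (r *\<^sub>R b) = r *\<^sub>R (a \<odot> b)"
    by (simp_all add: scaleC_of_real[symmetric] circ_scaleC_left circ_scaleC_right)
  show "\<exists>K. \<forall>a b. norm (a \<odot> b) \<le> norm a * norm b * K"
    by (rule exI[of _ 1]) (simp add: norm_circ_le)
qed

declare circ.zero_left [simp] circ.zero_right [simp]

text \<open>Polarization in the cubic variable: the defect \<open>D\<close> vanishes identically,
  and inclusion-exclusion over \<open>x\<close>, \<open>z\<close>, \<open>w\<close> extracts its
  trilinear part. By commutativity each product appears there twice, whence the factor 2 to be
  cancelled.\<close>

lemma jordan_identity_linearized:
  "((x \<odot> z) \<odot> y) \<odot> w + ((z \<odot> w) \<odot> y) \<odot> x + ((w \<odot> x) \<odot> y) \<odot> z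
    = (x \<odot> z) \<odot> (y \<odot> w) + (z \<odot> w) \<odot> (y \<odot> x) + (w \<odot> x) \<odot> (y \<odot> z)"
proof -
  define D where "D a = ((a \<odot> a) \<odot> y) \<odot> a - (a \<odot> y) \<odot> (a \<odot> a)" for a
  have "D a = 0" for a
    by (simp add: D_def jordan_identity)
  then have "D (x + z + w) - D (x + z) - D (z + w) - D (x + w) + D x + D z + D w = 0"
    by simp
  then have "2 *\<^sub>R (((x \<odot> z) \<odot> y) \<odot> w + ((z \<odot> w) \<odot> y) \<odot> x + ((w \<odot> x) \<odot> y) \<odot> z)
    = 2 *\<^sub>R ((x \<odot> z) \<odot> (y \<odot> w) + (z \<odot> w) \<odot> (y \<odot> x) + (w \<odot> x) \<odot> (y \<odot> z))"
    unfolding D_def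
    by (simp add: circ.add_left circ.add_right circ_commute scaleR_2 algebra_simps)
  then show ?thesis
    by simp
qed

text \<open>
  The right-hand side of the linearized identity is symmetric in all four variables, so the
  left-hand side is unchanged when \<open>y\<close> and \<open>w\<close> are exchanged.
\<close>

lemma circ_circ_circ:
  "((x \<odot> z) \<odot> y) \<odot> w =
    (x \<odot> z) \<odot> (y \<odot> w) + (y \<odot> x) \<odot> (z \<odot> w) + (y \<odot> z) \<odot> (x \<odot> w)
    - x \<odot> (y \<odot> (z \<odot> w)) - z \<odot> (y \<odot> (x \<odot> w))"
  using jordan_identity_linearized[of x z y w]
  by (simp add: circ_commute algebra_simps)

text \<open>The induction step for: multiplication by \<open>c\<close> commutes with multiplication by \<open>p(c)\<close>.\<close>

lemma circ_commutes_step: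
  assumes q: "\<And>y. c \<odot> (q \<odot> y) = q \<odot> (c \<odot> y)"
    and cq: "\<And>y. c \<odot> ((c \<odot> q) \<odot> y) = (c \<odot> q) \<odot> (c \<odot> y)"
  shows "c \<odot> ((c \<odot> (c \<odot> q)) \<odot> y) = (c \<odot> (c \<odot> q)) \<odot> (c \<odot> y)"
proof -
  have cc: "c \<odot> ((c \<odot> c) \<odot> y) = (c \<odot> c) \<odot> (c \<odot> y)" for y
    using jordan_identity[of c y] by (simp add: circ_commute)
  \<comment> \<open>This expresses multiplication by \<open>c \<odot> (c \<odot> q)\<close> through
    multiplications by \<open>q\<close>, \<open>c\<close>, \<open>c \<odot> q\<close> and
    \<open>c \<odot> c\<close>, each of which commutes with multiplication by
    \<open>c\<close>.\<close>
  have F: "(c \<odot> (c \<odot> q)) \<odot> w = (c \<odot> q) \<odot> (c \<odot> w) + (c \<odot> q) \<odot> (c \<odot> w) + (c \<odot> c) \<odot> (q \<odot> w)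
    - q \<odot> (c \<odot> (c \<odot> w)) - c \<odot> (c \<odot> (q \<odot> w))" for w
    using circ_circ_circ[of q c c w] by (simp add: circ_commute)
  show ?thesis
    unfolding F by (simp add: circ.add_right circ.diff_right q cq cc)
qed

end

section \<open>Polynomials in one element and the closed subalgebra they generate\<close>

locale unital_jordan_banach_algebra = jordan_banach_algebra +
  fixes unit :: 'a
  assumes unit_circ: "unit \<odot> a = a"
begin

lemma circ_unit: "a \<odot> unit = a"
  using unit_circ circ_commute by metis

text \<open>Horner's scheme fixes one bracketing of the powers of \<open>c\<close>; power
  associativity, in the form \<open>ev_mult\<close>, shows that products respect it.\<close>

definition ev :: "'a \<Rightarrow> complex poly \<Rightarrow> 'a" where
  "ev c p = fold_coeffs (\<lambda>a x. a *\<^sub>C unit + c \<odot> x) p 0"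

lemma ev_0 [simp]: "ev c 0 = 0"
  by (simp add: ev_def)

lemma ev_pCons [simp]: "ev c (pCons a p) = a *\<^sub>C unit + c \<odot> ev c p"
  by (cases "p = 0 \<and> a = 0") (auto simp: ev_def circ.zero_right)

lemma ev_1 [simp]: "ev c 1 = unit"
  by (simp only: one_pCons ev_pCons ev_0 circ.zero_right scale_one add_0_right)

lemma ev_add: "ev c (p + q) = ev c p + ev c q"
proof (induction p arbitrary: q)
  case (pCons a p)
  show ?case
    by (cases q) (simp add: pCons.IH circ.add_right scale_left_distrib)
qed simp

lemma ev_smult: "ev c (smult z p) = z *\<^sub>C ev c p"
  by (induction p) (simp_all add: circ_scaleC_right scale_right_distrib)

lemma ev_diff: "ev c (p - q) = ev c p - ev c q"
  using ev_add[of c "p - q" q] by simp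

lemma ev_sum: "ev c (\<Sum>i\<in>I. p i) = (\<Sum>i\<in>I. ev c (p i))"
  by (induction I rule: infinite_finite_induct) (simp_all add: ev_add)

text \<open>The two claims need a common induction: the first for \<open>pCons a p\<close> comes
  from the second for \<open>p\<close>, and \<open>circ_commutes_step\<close> needs both to give the
  second.\<close>

lemma ev_commutes:
  "c \<odot> (ev c p \<odot> y) = ev c p \<odot> (c \<odot> y)"
  "c \<odot> ((c \<odot> ev c p) \<odot> y) = (c \<odot> ev c p) \<odot> (c \<odot> y)"
proof (induction p arbitrary: y)
  case 0
  { case 1 show ?case by (simp add: circ.zero_left circ.zero_right) }
  { case 2 show ?case by (simp add: circ.zero_left circ.zero_right) }
next
  case (pCons a p)
  { case 1 show ?case
      using pCons.IH(2)[of y]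
      by (simp add: circ.add_left circ.add_right circ_scaleC_left circ_scaleC_right unit_circ) }
  { case 2 show ?case
      using circ_commutes_step[of c "ev c p" y, OF pCons.IH]
      by (simp add: circ.add_left circ.add_right circ_scaleC_left circ_scaleC_right circ_unit) }
qed

lemma ev_mult: "ev c (p * q) = ev c p \<odot> ev c q"
proof (induction p)
  case (pCons a p)
  have "c \<odot> (ev c p \<odot> ev c q) = (c \<odot> ev c p) \<odot> ev c q"
    using ev_commutes(1)[of c q "ev c p"]
    by (simp only: circ_commute[of "ev c p"] circ_commute[of "c \<odot> ev c p"])
  then show ?case
    by (simp add: ev_add ev_smult circ.add_left circ_scaleC_left unit_circ pCons)
qed (simp add: circ.zero_left)

text \<open>The closed unital subalgebra generated by \<open>c\<close>. It is associative, so
  computations in it are ordinary commutative algebra.\<close>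

definition polys :: "'a \<Rightarrow> 'a set" where
  "polys c = closure (range (ev c))"

lemma polysE:
  assumes "x \<in> polys c"
  obtains P where "(\<lambda>n. ev c (P n)) \<longlonglongrightarrow> x"
proof -
  obtain X where X: "\<And>n. X n \<in> range (ev c)" "X \<longlonglongrightarrow> x"
    using assms unfolding polys_def closure_sequential by blast
  from X(1) obtain P where "X = (\<lambda>n. ev c (P n))"
    unfolding image_iff by (metis (mono_tags) ext)
  with X(2) have "(\<lambda>n. ev c (P n)) \<longlonglongrightarrow> x"
    by simp
  then show ?thesis
    by (rule that)
qed

lemma ev_in_polys [simp]: "ev c p \<in> polys c"
  unfolding polys_def by (rule subsetD[OF closure_subset]) (rule rangeI)

lemma polysI: "(\<lambda>n. ev c (P n)) \<longlonglongrightarrow> x \<Longrightarrow> x \<in> polys c"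
  using closed_sequentially[of "polys c" "\<lambda>n. ev c (P n)" x] closed_closure[of "range (ev c)"]
  by (simp add: polys_def[symmetric])

lemma self_in_polys [simp]: "c \<in> polys c"
proof -
  have "ev c [:0, 1:] = c"
    by (simp add: circ_unit)
  then show ?thesis
    using ev_in_polys by metis
qed

lemma unit_in_polys [simp]: "unit \<in> polys c"
  using ev_in_polys ev_1 by metis

lemma closed_polys: "closed (polys c)"
  by (simp add: polys_def)

lemma polys_add [intro]:
  assumes "x \<in> polys c" "y \<in> polys c"
  shows "x + y \<in> polys c"
proof -
  obtain P Q where "(\<lambda>n. ev c (P n)) \<longlonglongrightarrow> x" "(\<lambda>n. ev c (Q n)) \<longlonglongrightarrow> y"
    using assms by (metis polysE)
  from tendsto_add[OF this] show ?thesis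
    by (intro polysI[of c "\<lambda>n. P n + Q n"]) (simp add: ev_add)
qed

lemma polys_circ [intro]:
  assumes "x \<in> polys c" "y \<in> polys c"
  shows "x \<odot> y \<in> polys c"
proof -
  obtain P Q where "(\<lambda>n. ev c (P n)) \<longlonglongrightarrow> x" "(\<lambda>n. ev c (Q n)) \<longlonglongrightarrow> y"
    using assms by (metis polysE)
  from circ.tendsto[OF this] show ?thesis
    by (intro polysI[of c "\<lambda>n. P n * Q n"]) (simp add: ev_mult)
qed

lemma polys_scaleC [intro]:
  assumes "x \<in> polys c"
  shows "z *\<^sub>C x \<in> polys c"
proof -
  obtain P where "(\<lambda>n. ev c (P n)) \<longlonglongrightarrow> x"
    using assms by (metis polysE)
  from scaleC.tendsto[OF tendsto_const this] show ?thesis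
    by (intro polysI[of c "\<lambda>n. smult z (P n)"]) (simp add: ev_smult)
qed

lemma polys_scaleR [intro]: "x \<in> polys c \<Longrightarrow> r *\<^sub>R x \<in> polys c"
  using polys_scaleC[of x c "of_real r"] by (simp add: scaleC_of_real)

lemma polys_diff [intro]: "x \<in> polys c \<Longrightarrow> y \<in> polys c \<Longrightarrow> x - y \<in> polys c"
  using polys_add[of x c "(- 1) *\<^sub>R y"] polys_scaleR[of y c "- 1"] by simp

lemma polys_assoc:
  assumes "x \<in> polys c" "y \<in> polys c" "z \<in> polys c"
  shows "(x \<odot> y) \<odot> z = x \<odot> (y \<odot> z)"
proof -
  obtain P Q R where *: "(\<lambda>n. ev c (P n)) \<longlonglongrightarrow> x" "(\<lambda>n. ev c (Q n)) \<longlonglongrightarrow> y" "(\<lambda>n. ev c (R n)) \<longlonglongrightarrow> z"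
    using assms by (metis polysE)
  have "(\<lambda>n. ev c (P n * Q n * R n)) \<longlonglongrightarrow> (x \<odot> y) \<odot> z"
    unfolding ev_mult by (intro circ.tendsto *)
  moreover have "(\<lambda>n. ev c (P n * Q n * R n)) \<longlonglongrightarrow> x \<odot> (y \<odot> z)"
    unfolding ev_mult mult.assoc by (intro circ.tendsto *)
  ultimately show ?thesis
    by (rule LIMSEQ_unique)
qed

lemma polys_left_commute:
  assumes "x \<in> polys c" "y \<in> polys c" "z \<in> polys c"
  shows "x \<odot> (y \<odot> z) = y \<odot> (x \<odot> z)"
  using polys_assoc[of x c y z] polys_assoc[of y c x z] assms by (simp add: circ_commute[of y x])

definition pow :: "'a \<Rightarrow> nat \<Rightarrow> 'a" where
  "pow x n = (((\<odot>) x) ^^ n) unit"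

lemma pow_simps [simp]: "pow x 0 = unit" "pow x (Suc n) = x \<odot> pow x n"
  by (simp_all add: pow_def)

lemma pow_in_polys [intro]: "x \<in> polys c \<Longrightarrow> pow x n \<in> polys c"
  by (induction n) auto

lemma ev_monom: "ev x (monom a n) = a *\<^sub>C pow x n"
  by (induction n) (simp_all add: monom_0 monom_Suc circ.zero_right circ_scaleC_right)

lemma ev_eq_sum:
  assumes "degree p \<le> n"
  shows "ev x p = (\<Sum>i\<le>n. coeff p i *\<^sub>C pow x i)"
  by (subst poly_as_sum_of_monoms'[OF assms, symmetric]) (simp only: ev_sum ev_monom)

lemma pow_mult_inverse:
  assumes "u \<in> polys c" "v \<in> polys c" "u \<odot> v = unit"
  shows "pow u n \<odot> pow v n = unit"
proof (induction n)
  case (Suc n)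
  have "pow u (Suc n) \<odot> pow v (Suc n) = u \<odot> (pow u n \<odot> (v \<odot> pow v n))"
    using assms by (simp add: polys_assoc[of u c] pow_in_polys polys_circ)
  also have "\<dots> = u \<odot> (v \<odot> (pow u n \<odot> pow v n))"
    using assms by (simp add: polys_left_commute[of "pow u n" c v] pow_in_polys)
  finally show ?case
    using Suc assms(3) by (simp add: circ_unit)
qed (simp add: unit_circ)

end

section \<open>Cauchy's coefficient bound, unitaries, and the passage from \<open>c\<close> to a
  unitary\<close>

lemma norm_coeff_le_sup_circle:
  fixes Q :: "complex poly"
  assumes "\<And>z. cmod z = 1 \<Longrightarrow> cmod (poly Q z) \<le> M"
  shows "cmod (coeff Q k) \<le> M"
proof -
  have "(deriv ^^ k) (poly Q) = poly ((pderiv ^^ k) Q)" for k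
  proof (induction k)
    case (Suc k)
    show ?case
      by (simp add: Suc fun_eq_iff DERIV_imp_deriv[OF poly_DERIV])
  qed simp
  moreover have "poly ((pderiv ^^ k) Q) 0 = fact k * coeff Q k"
    by (simp add: poly_0_coeff_0 coeff_higher_pderiv pochhammer_fact)
  moreover have "cmod ((deriv ^^ k) (poly Q) 0) \<le> fact k * M / 1 ^ k"
    by (rule Cauchy_inequality) (use assms in \<open>auto intro!: holomorphic_intros continuous_intros\<close>)
  ultimately show ?thesis
    by (simp add: norm_mult)
qed

sublocale unital_jb_star_algebra \<subseteq> unital_jordan_banach_algebra
  by unfold_locales (rule unit_circ)

context unital_jb_star_algebra
begin

lemma star_scaleR: "star (r *\<^sub>R a) = r *\<^sub>R star a"
  by (simp add: scaleC_of_real[symmetric] star_scaleC)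

lemma star_unit: "star unit = unit"
proof -
  have "star unit \<odot> star (star unit) = star (star unit)"
    by (simp only: star_circ[symmetric] unit_circ)
  then show ?thesis
    by (simp add: star_star circ_unit)
qed

text \<open>Gives continuity of the involution: expanding the norm axiom bounds
  \<open>norm a ^ 3\<close> by \<open>3 * norm a ^ 2 * norm (star a)\<close>, and
  \<open>norm a ^ 2\<close> cancels.\<close>

lemma norm_le_norm_star: "norm a \<le> 3 * norm (star a)"
proof (cases "a = 0")
  case False
  have "norm ((a \<odot> star a) \<odot> a) \<le> norm a ^ 2 * norm (star a)"
    using order_trans[OF norm_circ_le mult_right_mono[OF norm_circ_le norm_ge_zero], of a "star a" a]
    by (simp add: power2_eq_square mult_ac)
  moreover have "norm ((a \<odot> a) \<odot> star a) \<le> norm a ^ 2 * norm (star a)"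
    using order_trans[OF norm_circ_le mult_right_mono[OF norm_circ_le norm_ge_zero], of a a "star a"]
    by (simp add: power2_eq_square mult_ac)
  ultimately have "norm (2 *\<^sub>R ((a \<odot> star a) \<odot> a) - (a \<odot> a) \<odot> star a) \<le> 3 * (norm a ^ 2 * norm (star a))"
    using norm_triangle_ineq4[of "2 *\<^sub>R ((a \<odot> star a) \<odot> a)" "(a \<odot> a) \<odot> star a"] by simp
  then have "norm a ^ 3 \<le> 3 * (norm a ^ 2 * norm (star a))"
    using norm_jordan_U_star[of a] by (simp add: jordan_U_def)
  then have "norm a ^ 2 * norm a \<le> norm a ^ 2 * (3 * norm (star a))"
    by (simp add: power2_eq_square power3_eq_cube mult_ac)
  then show ?thesis
    using False by simp
qed simp

sublocale star: bounded_linear star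
proof
  show "\<exists>K. \<forall>x. norm (star x) \<le> norm x * K"
    using norm_le_norm_star[of "star _"] by (intro exI[of _ 3]) (simp add: star_star mult.commute)
qed (simp_all add: star_add star_scaleR)

lemma jordan_U_self_adjoint: "star b = b \<Longrightarrow> norm (b \<odot> (b \<odot> b)) = norm b ^ 3"
  using norm_jordan_U_star[of b] by (simp add: jordan_U_def circ_commute scaleR_2)

text \<open>In the associative \<open>polys c\<close> one has
  \<open>jordan_U circ w (star w) = w\<close>, so the norm axiom reads
  \<open>norm w = norm w ^ 3\<close>, which leaves only 0 and 1.\<close>

lemma norm_unitary_le_1:
  assumes "w \<in> polys c" "star w \<in> polys c" "w \<odot> star w = unit"
  shows "norm w \<le> 1"
proof -
  have "(w \<odot> w) \<odot> star w = w"
    using assms by (simp add: polys_assoc circ_unit)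
  then have "jordan_U circ w (star w) = w"
    using assms by (simp add: jordan_U_def unit_circ scaleR_2)
  then have "norm w = norm w ^ 3"
    using norm_jordan_U_star[of w] by simp
  then have "norm w * (norm w ^ 2 - 1) = 0"
    by (simp add: power2_eq_square power3_eq_cube algebra_simps)
  then show ?thesis
    by (auto simp: power2_eq_1_iff)
qed

lemma star_pow: "star (pow u n) = pow (star u) n"
  by (induction n) (simp_all add: star_unit star_circ)

lemma star_ev_real:
  assumes "star c = c" "\<And>i. coeff p i \<in> \<real>"
  shows "star (ev c p) = ev c p"
proof -
  have "cnj (coeff p i) = coeff p i" for i
    using assms(2) by (simp add: Reals_cnj_iff)
  then show ?thesis
    by (simp add: ev_eq_sum[OF order_refl] star.sum star_scaleC star_pow assms(1))
qed

text \<open>Here \<open>y\<close> is \<open>1 - sqrt (1 - c^2)\<close>, found as the fixed point of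
  \<open>T\<close>. On the ball of radius 1/2 this map contracts with constant 1/2, and
  \<open>S\<close> keeps the fixed point self-adjoint and in \<open>polys c\<close>.\<close>

lemma exists_one_minus_sqrt:
  assumes c: "star c = c" "norm c \<le> 1 / 2"
  obtains y where "y \<in> polys c" "star y = y" "y + y = c \<odot> c + y \<odot> y"
proof -
  define S where "S = polys c \<inter> cball 0 (1 / 2) \<inter> {y. star y = y}"
  define T where "T y = (1 / 2 :: real) *\<^sub>R (c \<odot> c + y \<odot> y)" for y
  have sq: "norm (y \<odot> y) \<le> 1 / 4" if "norm y \<le> 1 / 2" for y
    using order_trans[OF norm_circ_le mult_mono[OF that that]] by simp
  have "closed {y. star y = y}"
    by (intro closed_Collect_eq star.continuous_on continuous_on_id)
  then have "complete S"
    unfolding S_def complete_eq_closed by (intro closed_Int closed_polys closed_cball)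
  moreover have "0 \<in> S"
    using ev_in_polys[of c 0] by (simp add: S_def star.zero)
  moreover have "T ` S \<subseteq> S"
  proof clarify
    fix y
    assume "y \<in> S"
    then have y: "y \<in> polys c" "norm y \<le> 1 / 2" "star y = y"
      by (auto simp: S_def)
    have "norm (T y) \<le> 1 / 2"
      using norm_triangle_ineq[of "c \<odot> c" "y \<odot> y"] sq[OF c(2)] sq[OF y(2)] by (simp add: T_def)
    moreover have "T y \<in> polys c"
      unfolding T_def by (intro polys_scaleR polys_add polys_circ self_in_polys y)
    ultimately show "T y \<in> S"
      by (simp add: S_def T_def star_scaleR star_add star_circ c y)
  qed
  moreover have "dist (T x) (T y) \<le> 1 / 2 * dist x y" if "x \<in> S" "y \<in> S" for x y
  proof -
    have xy: "norm x \<le> 1 / 2" "norm y \<le> 1 / 2"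
      using that by (auto simp: S_def)
    have "(x + y) \<odot> (x - y) = x \<odot> x - y \<odot> y"
      by (simp add: circ.add_left circ.diff_right circ_commute[of y x])
    then have "T x - T y = (1 / 2 :: real) *\<^sub>R ((x + y) \<odot> (x - y))"
      by (simp add: T_def scaleR_diff_right[symmetric])
    moreover have "norm ((x + y) \<odot> (x - y)) \<le> 1 * norm (x - y)"
      using norm_triangle_ineq[of x y] xy
      by (intro order_trans[OF norm_circ_le] mult_right_mono) auto
    ultimately show ?thesis
      by (simp add: dist_norm)
  qed
  ultimately have "\<exists>!y\<in>S. T y = y"
    by (intro Banach_fix[where c = "1 / 2"]) auto
  then obtain y where y: "y \<in> S" "T y = y"
    by blast
  have "y + y = 2 *\<^sub>R T y"
    by (simp add: y scaleR_2)
  also have "\<dots> = c \<odot> c + y \<odot> y"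
    by (simp add: T_def)
  finally show ?thesis
    using y by (intro that[of y]) (auto simp: S_def)
qed

text \<open>
  A self-adjoint \<open>c\<close> of small norm is the real part of the unitary
  \<open>u = c + \<i> \<surd>(1 - c\<^sup>2)\<close>, so polynomials in \<open>c\<close> become Laurent polynomials in \<open>u\<close>.
\<close>

lemma exists_unitary:
  assumes c: "star c = c" "norm c \<le> 1 / 2"
  obtains u where "u \<in> polys c" "star u \<in> polys c" "u \<odot> star u = unit" "u + star u = 2 *\<^sub>R c"
proof -
  obtain y where y: "y \<in> polys c" "star y = y" "y + y = c \<odot> c + y \<odot> y"
    using exists_one_minus_sqrt[OF c] .
  define s where "s = unit - y"
  have s: "s \<in> polys c" "star s = s"
    unfolding s_def using y by (auto simp: star.diff star_unit)
  have "s \<odot> s = unit - (y + y) + y \<odot> y"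
    by (simp add: s_def circ.diff_left circ.diff_right unit_circ circ_unit)
  then have ss: "s \<odot> s = unit - c \<odot> c"
    unfolding y(3) by simp
  define u where "u = c + \<i> *\<^sub>C s"
  have su: "star u = c - \<i> *\<^sub>C s"
    by (simp add: u_def star_add star_scaleC c s)
  show ?thesis
  proof (rule that)
    show "u \<in> polys c"
      unfolding u_def using s by (intro polys_add polys_scaleC) auto
    show "star u \<in> polys c"
      unfolding su using s by (intro polys_diff polys_scaleC) auto
    show "u \<odot> star u = unit"
      unfolding su unfolding u_def
      by (simp add: circ.add_left circ.diff_right circ_scaleC_left circ_scaleC_right ss
          circ_commute[of s c] scale_right_diff_distrib scale_right_distrib)
    show "u + star u = 2 *\<^sub>R c"
      unfolding su unfolding u_def by (simp add: scaleR_2)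
  qed
qed

text \<open>As \<open>c\<close> is half the sum of \<open>u\<close> and its inverse
  \<open>star u\<close>, \<open>ev c p\<close> is a Laurent polynomial in \<open>u\<close>; the
  factor \<open>pow u d\<close> clears the negative powers. On the unit circle
  \<open>(z + 1 / z) / 2\<close> is \<open>Re z\<close>, so \<open>Q\<close> is controlled by
  \<open>p\<close> on [-1, 1].\<close>

lemma unitary_transfer:
  assumes u: "u \<in> polys c" "u \<odot> star u = unit" "u + star u = 2 *\<^sub>R c"
    and "degree p \<le> d"
  obtains Q where "degree Q \<le> 2 * d" "ev u Q = pow u d \<odot> ev c p"
    "\<And>z. cmod z = 1 \<Longrightarrow> poly Q z = z ^ d * poly p (of_real (Re z))"
  using \<open>degree p \<le> d\<close>
proof (induction d arbitrary: p thesis)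
  case 0
  then obtain a where "p = [:a:]"
    by (auto elim: degree_eq_zeroE)
  then show ?case
    by (intro 0(1)[of "[:a:]"]) (simp_all add: circ_scaleC_right unit_circ)
next
  case (Suc d)
  obtain a q where p: "p = pCons a q"
    by (cases p)
  then have "degree q \<le> d"
    using Suc.prems(2) by (simp split: if_splits)
  then obtain Q where Q: "degree Q \<le> 2 * d" "ev u Q = pow u d \<odot> ev c q"
    "\<And>z. cmod z = 1 \<Longrightarrow> poly Q z = z ^ d * poly q (of_real (Re z))"
    using Suc.IH[of q] by blast
  \<comment> \<open>As a function, \<open>R\<close> is \<open>z * (z + 1 / z) / 2\<close>: one
    factor \<open>u\<close> absorbs one factor \<open>c\<close>.\<close>
  define R :: "complex poly" where "R = [:1 / 2, 0, 1 / 2:]"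
  have "2 *\<^sub>R (u \<odot> c) = u \<odot> (u + star u)"
    using u by (simp add: circ.scaleR_right)
  then have "u \<odot> c = (1 / 2 :: real) *\<^sub>R (u \<odot> u + unit)"
    using u(2) by (simp add: circ.add_right) (metis scaleR_half_double scaleR_2 scaleR_scaleR scaleR_left_distrib)
  also have "\<dots> = ev u R"
    by (simp add: R_def scaleC_of_real[symmetric] circ_scaleC_right circ_unit scale_right_distrib add.commute)
  finally have R: "ev u R = u \<odot> c" ..
  have z: "poly R z = z * of_real (Re z)" if "cmod z = 1" for z
  proof -
    have "z * cnj z = 1"
      using that by (simp add: complex_norm_square[symmetric])
    moreover have "of_real (Re z) = (z + cnj z) / 2"
      by (simp add: complex_add_cnj)
    ultimately show ?thesis
      by (simp add: R_def add_divide_distrib distrib_left)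
  qed
  show ?case
  proof (rule Suc.prems(1))
    have "degree (R * Q) \<le> 2 * Suc d"
      using degree_mult_le[of R Q] Q(1) by (simp add: R_def)
    then show "degree (monom a (Suc d) + R * Q) \<le> 2 * Suc d"
      by (intro degree_add_le order_trans[OF degree_monom_le]) auto
    have "(u \<odot> pow u d) \<odot> (c \<odot> ev c q) = u \<odot> (pow u d \<odot> (c \<odot> ev c q))"
      using u(1) by (intro polys_assoc[where c = c]) auto
    also have "pow u d \<odot> (c \<odot> ev c q) = c \<odot> (pow u d \<odot> ev c q)"
      using u(1) by (intro polys_left_commute[where c = c]) auto
    also have "u \<odot> \<dots> = (u \<odot> c) \<odot> (pow u d \<odot> ev c q)"
      using u(1) by (intro polys_assoc[where c = c, symmetric]) auto
    finally show "ev u (monom a (Suc d) + R * Q) = pow u (Suc d) \<odot> ev c p"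
      by (simp add: ev_add ev_monom ev_mult R Q(2) p circ.add_right circ_scaleC_right circ_unit)
    show "poly (monom a (Suc d) + R * Q) z = z ^ Suc d * poly p (of_real (Re z))" if "cmod z = 1" for z
      using that by (simp add: z Q(3) p poly_monom algebra_simps)
  qed
qed

end

section \<open>Norm bounds and continuous functional calculus for a small self-adjoint
  element\<close>

locale small_self_adjoint = unital_jb_star_algebra +
  fixes c :: 'a
  assumes self_adjoint: "star c = c"
    and small: "norm c \<le> 1 / 2"
begin

text \<open>
  The factor is polynomial in the degree, so it disappears on passing to high powers of \<open>p\<close>.
\<close>

lemma norm_ev_le_degree:
  assumes p: "degree p \<le> d" "\<And>t. t \<in> {-1..1} \<Longrightarrow> cmod (poly p (of_real t)) \<le> M"
  shows "norm (ev c p) \<le> (2 * real d + 1) * M"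
proof -
  obtain u where u: "u \<in> polys c" "star u \<in> polys c" "u \<odot> star u = unit" "u + star u = 2 *\<^sub>R c"
    using exists_unitary[OF self_adjoint small] .
  obtain Q where Q: "degree Q \<le> 2 * d" "ev u Q = pow u d \<odot> ev c p"
    "\<And>z. cmod z = 1 \<Longrightarrow> poly Q z = z ^ d * poly p (of_real (Re z))"
    using unitary_transfer[OF u(1,3,4) p(1)] by blast
  have inv: "pow u n \<odot> pow (star u) n = unit" for n
    by (rule pow_mult_inverse[OF u(1-3)])
  have pow_le: "norm (pow u n) \<le> 1" for n
    using u(1,2) inv[of n] by (intro norm_unitary_le_1[of _ c]) (auto simp: star_pow)
  have pow_le': "norm (pow (star u) n) \<le> 1" for n
    using u(1,2) inv[of n] by (intro norm_unitary_le_1[of _ c]) (auto simp: star_pow star_star circ_commute)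
  have "cmod (coeff Q i) \<le> M" for i
  proof (rule norm_coeff_le_sup_circle)
    fix z assume z: "cmod z = 1"
    then have "Re z \<in> {-1..1}"
      using abs_Re_le_cmod[of z] by auto
    from p(2)[OF this] show "cmod (poly Q z) \<le> M"
      using z by (simp add: Q(3) norm_mult norm_power)
  qed
  then have "norm (coeff Q i *\<^sub>C pow u i) \<le> M * 1" for i
    unfolding norm_scaleC using order_trans[OF norm_ge_zero] by (intro mult_mono pow_le) auto
  then have "norm (ev u Q) \<le> of_nat (card {..2 * d}) * M"
    unfolding ev_eq_sum[OF Q(1)] by (intro sum_norm_bound) auto
  then have *: "norm (pow u d \<odot> ev c p) \<le> (2 * real d + 1) * M"
    by (simp add: Q(2) add.commute)
  have "pow (star u) d \<odot> (pow u d \<odot> ev c p) = (pow (star u) d \<odot> pow u d) \<odot> ev c p"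
    using u(1,2) by (intro polys_assoc[where c = c, symmetric]) auto
  then have "ev c p = pow (star u) d \<odot> (pow u d \<odot> ev c p)"
    using inv[of d] by (simp add: circ_commute[of "pow (star u) d"] unit_circ)
  then have "norm (ev c p) \<le> norm (pow (star u) d) * norm (pow u d \<odot> ev c p)"
    using norm_circ_le by metis
  also have "\<dots> \<le> 1 * norm (pow u d \<odot> ev c p)"
    by (intro mult_right_mono pow_le') auto
  finally show ?thesis
    using * by simp
qed

text \<open>Powers of 3 occur because the norm identity for self-adjoint elements concerns cubes;
  real coefficients keep the values of all powers of \<open>p\<close> at \<open>c\<close>
  self-adjoint.\<close>

lemma norm_ev_real_power:
  assumes "\<And>i. coeff p i \<in> \<real>"
  shows "norm (ev c (p ^ 3 ^ n)) = norm (ev c p) ^ 3 ^ n"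
proof (induction n)
  case (Suc n)
  have "coeff (p ^ k) i \<in> \<real>" for k i
    using assms by (induction k arbitrary: i) (auto simp: coeff_mult coeff_1)
  then have "norm (ev c (p ^ 3 ^ n) \<odot> (ev c (p ^ 3 ^ n) \<odot> ev c (p ^ 3 ^ n))) = norm (ev c (p ^ 3 ^ n)) ^ 3"
    by (intro jordan_U_self_adjoint star_ev_real self_adjoint)
  moreover have "3 ^ Suc n = 3 ^ n + (3 ^ n + (3 ^ n :: nat))"
    by simp
  then have "ev c (p ^ 3 ^ Suc n) = ev c (p ^ 3 ^ n) \<odot> (ev c (p ^ 3 ^ n) \<odot> ev c (p ^ 3 ^ n))"
    by (simp only: power_add ev_mult)
  ultimately show ?case
    by (simp add: Suc power_mult[symmetric] mult.commute[of 3])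
qed simp

text \<open>The degree bound is applied to \<open>p ^ 3 ^ n\<close>. Its prefactor grows only
  linearly in the exponent \<open>3 ^ n\<close>, so if \<open>norm (ev c p)\<close> exceeded
  \<open>M\<close>, it would lose against the geometric decay of \<open>q ^ 3 ^ n\<close>.\<close>

lemma norm_ev_real_le:
  assumes p: "\<And>i. coeff p i \<in> \<real>" "\<And>t. t \<in> {-1..1} \<Longrightarrow> cmod (poly p (of_real t)) \<le> M"
  shows "norm (ev c p) \<le> M"
proof (rule ccontr)
  assume "\<not> norm (ev c p) \<le> M"
  moreover have "0 \<le> M"
    using order_trans[OF norm_ge_zero p(2)[of 0]] by simp
  ultimately have N: "M < norm (ev c p)" "0 < norm (ev c p)" "0 \<le> M"
    by auto
  define q where "q = M / norm (ev c p)"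
  have q: "0 \<le> q" "q < 1"
    using N by (auto simp: q_def)
  define d where "d = degree p"
  have le: "1 \<le> 2 * real d * (real (3 ^ n) * q ^ 3 ^ n) + q ^ 3 ^ n" for n :: nat
  proof -
    have "norm (ev c (p ^ 3 ^ n)) \<le> (2 * real (d * 3 ^ n) + 1) * M ^ 3 ^ n"
      by (intro norm_ev_le_degree)
        (auto simp: d_def poly_power norm_power degree_power_le intro!: power_mono p)
    then have "norm (ev c p) ^ 3 ^ n \<le> (2 * real (d * 3 ^ n) + 1) * M ^ 3 ^ n"
      by (simp only: norm_ev_real_power[OF p(1)])
    then have "1 \<le> (2 * real (d * 3 ^ n) + 1) * (M ^ 3 ^ n / norm (ev c p) ^ 3 ^ n)"
      using N by (simp add: field_simps)
    then show ?thesis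
      by (simp add: q_def power_divide[symmetric] algebra_simps)
  qed
  have "(\<lambda>m. 2 * real d * (real m * q ^ m) + q ^ m) \<longlonglongrightarrow> 2 * real d * 0 + 0"
    using q by (intro tendsto_intros powser_times_n_limit_0 LIMSEQ_power_zero) auto
  moreover have "strict_mono (\<lambda>n. 3 ^ n :: nat)"
    by (simp add: strict_mono_def)
  ultimately have "(\<lambda>n. 2 * real d * (real (3 ^ n) * q ^ 3 ^ n) + q ^ 3 ^ n) \<longlonglongrightarrow> 2 * real d * 0 + 0"
    using LIMSEQ_subseq_LIMSEQ unfolding comp_def by fastforce
  then have "1 \<le> 2 * real d * 0 + (0 :: real)"
    by (rule LIMSEQ_le_const) (use le in blast)
  then show False
    by simp
qed

text \<open>The real and imaginary parts of the coefficients give two real polynomials, which on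
  real \<open>t\<close> are the real and imaginary parts of \<open>p\<close>. Adding their bounds
  costs the factor 2.\<close>

lemma norm_ev_le:
  assumes p: "\<And>t. t \<in> {-1..1} \<Longrightarrow> cmod (poly p (of_real t)) \<le> M"
  shows "norm (ev c p) \<le> 2 * M"
proof -
  define pr where "pr = map_poly (\<lambda>z. of_real (Re z) :: complex) p"
  define pi where "pi = map_poly (\<lambda>z. of_real (Im z) :: complex) p"
  have "p = pr + smult \<i> pi"
    by (rule poly_eqI) (simp add: pr_def pi_def coeff_map_poly complex_eq[symmetric])
  then have "ev c p = ev c pr + \<i> *\<^sub>C ev c pi"
    by (metis ev_add ev_smult)
  then have "norm (ev c p) \<le> norm (ev c pr) + norm (ev c pi)"
    using norm_triangle_ineq[of "ev c pr" "\<i> *\<^sub>C ev c pi"] by (simp add: norm_scaleC)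
  moreover have "norm (ev c pr) \<le> M"
  proof (rule norm_ev_real_le)
    fix t :: real assume "t \<in> {-1..1}"
    moreover have "poly pr (of_real t) = of_real (Re (poly p (of_real t)))"
      unfolding pr_def by (induction p) (auto simp: map_poly_pCons)
    ultimately show "cmod (poly pr (of_real t)) \<le> M"
      using order_trans[OF abs_Re_le_cmod p] by simp
  qed (simp add: pr_def coeff_map_poly)
  moreover have "norm (ev c pi) \<le> M"
  proof (rule norm_ev_real_le)
    fix t :: real assume "t \<in> {-1..1}"
    moreover have "poly pi (of_real t) = of_real (Im (poly p (of_real t)))"
      unfolding pi_def by (induction p) (auto simp: map_poly_pCons)
    ultimately show "cmod (poly pi (of_real t)) \<le> M"
      using order_trans[OF abs_Im_le_cmod p] by simp
  qed (simp add: pi_def coeff_map_poly)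
  ultimately show ?thesis
    by simp
qed

text \<open>One polynomial sequence must witness both limits. As a relation, the calculus has its
  algebraic rules and norm bound before existence is known.\<close>

definition calc :: "(real \<Rightarrow> complex) \<Rightarrow> 'a \<Rightarrow> bool" where
  "calc g b \<longleftrightarrow> (\<exists>P. uniform_limit {-1..1} (\<lambda>n t. poly (P n) (of_real t)) g sequentially
    \<and> (\<lambda>n. ev c (P n)) \<longlonglongrightarrow> b)"

lemma calcI:
  assumes "uniform_limit {-1..1} (\<lambda>n t. poly (P n) (of_real t)) g sequentially"
    and "(\<lambda>n. ev c (P n)) \<longlonglongrightarrow> b"
  shows "calc g b"
  using assms by (auto simp: calc_def)

lemma calcE:
  assumes "calc g b"
  obtains P where "uniform_limit {-1..1} (\<lambda>n t. poly (P n) (of_real t)) g sequentially"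
    "(\<lambda>n. ev c (P n)) \<longlonglongrightarrow> b"
  using assms by (auto simp: calc_def)

lemma calc_poly: "calc (\<lambda>t. poly p (of_real t)) (ev c p)"
  by (rule calcI[of "\<lambda>_. p"]) (auto intro: uniform_limit_const)

lemma calc_cong:
  assumes "calc g b" "\<And>t. t \<in> {-1..1} \<Longrightarrow> g t = h t"
  shows "calc h b"
proof -
  have "uniform_limit {-1..1} F g sequentially \<longleftrightarrow> uniform_limit {-1..1} F h sequentially" for F
    by (rule uniform_limit_cong') (use assms(2) in auto)
  then show ?thesis
    using assms(1) by (simp add: calc_def)
qed

lemma calc_add:
  assumes "calc g b" "calc h b'"
  shows "calc (\<lambda>t. g t + h t) (b + b')"
proof -
  obtain P Q where P: "uniform_limit {-1..1} (\<lambda>n t. poly (P n) (of_real t)) g sequentially"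
      "(\<lambda>n. ev c (P n)) \<longlonglongrightarrow> b"
    and Q: "uniform_limit {-1..1} (\<lambda>n t. poly (Q n) (of_real t)) h sequentially"
      "(\<lambda>n. ev c (Q n)) \<longlonglongrightarrow> b'"
    using assms by (metis calcE)
  show ?thesis
    using uniform_limit_add[OF P(1) Q(1)] tendsto_add[OF P(2) Q(2)]
    by (intro calcI[of "\<lambda>n. P n + Q n"]) (simp_all add: ev_add)
qed

lemma calc_mult:
  assumes "calc g b" "calc h b'" "continuous_on {-1..1} g" "continuous_on {-1..1} h"
  shows "calc (\<lambda>t. g t * h t) (b \<odot> b')"
proof -
  obtain P Q where P: "uniform_limit {-1..1} (\<lambda>n t. poly (P n) (of_real t)) g sequentially"
      "(\<lambda>n. ev c (P n)) \<longlonglongrightarrow> b"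
    and Q: "uniform_limit {-1..1} (\<lambda>n t. poly (Q n) (of_real t)) h sequentially"
      "(\<lambda>n. ev c (Q n)) \<longlonglongrightarrow> b'"
    using assms by (metis calcE)
  have "bounded (g ` {-1..1})" "bounded (h ` {-1..1})"
    using assms(3,4) by (auto intro: compact_imp_bounded compact_continuous_image)
  from uniform_lim_mult[OF P(1) Q(1) this] circ.tendsto[OF P(2) Q(2)] show ?thesis
    by (intro calcI[of "\<lambda>n. P n * Q n"]) (simp_all add: ev_mult)
qed

lemma calc_const: "calc (\<lambda>_. z) (z *\<^sub>C unit)"
  using calc_poly[of "[:z:]"] by simp

lemma calc_norm:
  assumes "calc g b" "\<And>t. t \<in> {-1..1} \<Longrightarrow> cmod (g t) \<le> M"
  shows "norm b \<le> 2 * M"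
proof (rule field_le_epsilon)
  fix e :: real assume "0 < e"
  obtain P where P: "uniform_limit {-1..1} (\<lambda>n t. poly (P n) (of_real t)) g sequentially"
      "(\<lambda>n. ev c (P n)) \<longlonglongrightarrow> b"
    using assms(1) by (rule calcE)
  have "\<forall>\<^sub>F n in sequentially. \<forall>t\<in>{-1..1}. dist (poly (P n) (of_real t)) (g t) < e / 2"
    using uniform_limitD[OF P(1), of "e / 2"] \<open>0 < e\<close> by simp
  then have "\<forall>\<^sub>F n in sequentially. norm (ev c (P n)) \<le> 2 * M + e"
  proof eventually_elim
    case (elim n)
    have "norm (ev c (P n)) \<le> 2 * (M + e / 2)"
    proof (rule norm_ev_le)
      fix t :: real assume t: "t \<in> {-1..1}"
      then have "cmod (poly (P n) (of_real t) - g t) < e / 2"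
        using elim by (simp add: dist_norm)
      then show "cmod (poly (P n) (of_real t)) \<le> M + e / 2"
        using norm_triangle_sub[of "poly (P n) (of_real t)" "g t"] assms(2)[OF t] by linarith
    qed
    then show ?case
      by simp
  qed
  then show "norm b \<le> 2 * M + e"
    by (intro tendsto_upperbound[OF tendsto_norm[OF P(2)]]) auto
qed

lemma calc_scale: "calc g b \<Longrightarrow> continuous_on {-1..1} g \<Longrightarrow> calc (\<lambda>t. z * g t) (z *\<^sub>C b)"
  using calc_mult[OF calc_const] by (simp add: circ_scaleC_left unit_circ)

lemma calc_diff:
  assumes "calc g b" "calc h b'" "continuous_on {-1..1} h"
  shows "calc (\<lambda>t. g t - h t) (b - b')"
  using calc_add[OF assms(1) calc_scale[OF assms(2,3), of "- 1"]] by simp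

lemma calc_unique:
  assumes "calc g b" "calc g b'" "continuous_on {-1..1} g"
  shows "b = b'"
  using calc_norm[OF calc_diff[OF assms], of 0] by simp

end

lemma uniform_approximation_by_poly:
  fixes g :: "real \<Rightarrow> complex"
  assumes "compact S" "continuous_on S g" "0 < e"
  obtains p where "\<And>t. t \<in> S \<Longrightarrow> dist (poly p (of_real t)) (g t) < e"
proof -
  have real: "\<exists>p. \<forall>t\<in>S. cmod (poly p (of_real t) - of_real (h t)) < e / 2"
    if h: "continuous_on S h" for h :: "real \<Rightarrow> real"
  proof -
    obtain k where k: "real_polynomial_function k" "\<And>t. t \<in> S \<Longrightarrow> \<bar>h t - k t\<bar> < e / 2"
      using Stone_Weierstrass_real_polynomial_function[OF assms(1) h, of "e / 2"] assms(3) by auto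
    then obtain a n where a: "k = (\<lambda>x. \<Sum>i\<le>n. a i * x ^ i)"
      unfolding real_polynomial_function_iff_sum by blast
    have "poly (\<Sum>i\<le>n. monom (of_real (a i)) i) (of_real t) = (of_real (k t) :: complex)" for t
      by (simp add: a poly_sum poly_monom)
    then have "cmod (poly (\<Sum>i\<le>n. monom (of_real (a i)) i) (of_real t) - of_real (h t)) = \<bar>h t - k t\<bar>" for t
      by (simp only: of_real_diff[symmetric] norm_of_real abs_minus_commute)
    then show ?thesis
      using k(2) by (intro exI[of _ "\<Sum>i\<le>n. monom (of_real (a i)) i"]) simp
  qed
  obtain p q where p: "\<And>t. t \<in> S \<Longrightarrow> cmod (poly p (of_real t) - of_real (Re (g t))) < e / 2"
    and q: "\<And>t. t \<in> S \<Longrightarrow> cmod (poly q (of_real t) - of_real (Im (g t))) < e / 2"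
    using real[OF continuous_on_Re[OF assms(2)]] real[OF continuous_on_Im[OF assms(2)]] by blast
  show ?thesis
  proof (rule that)
    fix t assume t: "t \<in> S"
    have eq: "poly (p + smult \<i> q) (of_real t) - g t =
        (poly p (of_real t) - of_real (Re (g t))) + \<i> * (poly q (of_real t) - of_real (Im (g t)))"
      using complex_eq[of "g t"] by (simp add: algebra_simps)
    have "cmod (poly (p + smult \<i> q) (of_real t) - g t) < e / 2 + e / 2"
      unfolding eq by (rule norm_add_less[OF p[OF t]]) (use q[OF t] in \<open>simp add: norm_mult\<close>)
    then show "dist (poly (p + smult \<i> q) (of_real t)) (g t) < e"
      by (simp only: dist_norm field_sum_of_halves)
  qed
qed

context small_self_adjoint
begin

lemma calc_exists:
  assumes "continuous_on {-1..1} g"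
  shows "\<exists>b. calc g b"
proof -
  have "\<exists>p. \<forall>t\<in>{-1..1}. dist (poly p (of_real t)) (g t) < inverse (Suc n)" for n
    using uniform_approximation_by_poly[OF _ assms, of "inverse (Suc n)"]
    by (metis compact_Icc inverse_positive_iff_positive of_nat_0_less_iff zero_less_Suc)
  then obtain P where P: "\<And>n t. t \<in> {-1..1} \<Longrightarrow> dist (poly (P n) (of_real t)) (g t) < inverse (Suc n)"
    by metis
  have lim: "uniform_limit {-1..1} (\<lambda>n t. poly (P n) (of_real t)) g sequentially"
  proof (rule uniform_limitI)
    fix e :: real assume "0 < e"
    then have "\<forall>\<^sub>F n in sequentially. inverse (Suc n) < e"
      using LIMSEQ_inverse_real_of_nat by (rule order_tendstoD(2)[rotated])
    then show "\<forall>\<^sub>F n in sequentially. \<forall>t\<in>{-1..1}. dist (poly (P n) (of_real t)) (g t) < e"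
      by eventually_elim (use P in \<open>force intro: less_trans\<close>)
  qed
  have "Cauchy (\<lambda>n. ev c (P n))"
  proof (rule metric_CauchyI)
    fix e :: real assume "0 < e"
    \<comment> \<open>The 4 pays for the triangle inequality and for the factor 2 of
      \<open>norm_ev_le\<close>, through which uniform closeness on [-1, 1] becomes closeness at
      \<open>c\<close>.\<close>
    then obtain N where N: "inverse (real (Suc N)) < e / 4"
      using reals_Archimedean[of "e / 4"] by auto
    have "dist (ev c (P m)) (ev c (P n)) < e" if "N \<le> m" "N \<le> n" for m n
    proof -
      have le: "dist (poly (P k) (of_real t)) (g t) \<le> inverse (real (Suc N))"
        if "N \<le> k" "t \<in> {-1..1}" for k t
        using P[OF that(2), of k] that(1) by (smt (verit) inverse_le_iff_le of_nat_0_less_iff of_nat_mono Suc_le_mono zero_less_Suc)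
      have "norm (ev c (P m - P n)) \<le> 2 * (2 * inverse (real (Suc N)))"
      proof (rule norm_ev_le)
        fix t :: real assume "t \<in> {-1..1}"
        from le[OF \<open>N \<le> m\<close> this] le[OF \<open>N \<le> n\<close> this]
        have "dist (poly (P m) (of_real t)) (poly (P n) (of_real t)) \<le> 2 * inverse (real (Suc N))"
          using dist_triangle2[of "poly (P m) (of_real t)" "poly (P n) (of_real t)" "g t"] by linarith
        then show "cmod (poly (P m - P n) (of_real t)) \<le> 2 * inverse (real (Suc N))"
          by (simp add: dist_norm)
      qed
      then show ?thesis
        using N by (simp add: dist_norm ev_diff)
    qed
    then show "\<exists>N. \<forall>m\<ge>N. \<forall>n\<ge>N. dist (ev c (P m)) (ev c (P n)) < e"
      by blast
  qed
  then obtain b where "(\<lambda>n. ev c (P n)) \<longlonglongrightarrow> b"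
    using Cauchy_convergent convergent_def by blast
  with lim show ?thesis
    using calcI by blast
qed

definition \<Phi> :: "(real \<Rightarrow> complex) \<Rightarrow> 'a" where
  "\<Phi> g = (SOME b. calc g b)"

lemma calc_\<Phi>: "continuous_on {-1..1} g \<Longrightarrow> calc g (\<Phi> g)"
  unfolding \<Phi>_def using calc_exists by (rule someI_ex)

lemma \<Phi>_eqI: "continuous_on {-1..1} g \<Longrightarrow> calc g b \<Longrightarrow> \<Phi> g = b"
  using calc_unique calc_\<Phi> by blast

lemma \<Phi>_const: "\<Phi> (\<lambda>_. z) = z *\<^sub>C unit"
  by (rule \<Phi>_eqI[OF _ calc_const]) simp

lemma \<Phi>_of_real: "\<Phi> of_real = c"
  by (rule \<Phi>_eqI) (use calc_poly[of "[:0, 1:]"] in \<open>auto simp: circ_unit intro: continuous_intros\<close>)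

context
  fixes g h :: "real \<Rightarrow> complex"
  assumes g: "continuous_on {-1..1} g" and h: "continuous_on {-1..1} h"
begin

lemma \<Phi>_diff: "\<Phi> (\<lambda>t. g t - h t) = \<Phi> g - \<Phi> h"
  by (rule \<Phi>_eqI) (intro continuous_intros g h calc_diff calc_\<Phi>)+

lemma \<Phi>_mult: "\<Phi> (\<lambda>t. g t * h t) = \<Phi> g \<odot> \<Phi> h"
  by (rule \<Phi>_eqI) (intro continuous_intros g h calc_mult calc_\<Phi>)+

lemma \<Phi>_cong: "(\<And>t. t \<in> {-1..1} \<Longrightarrow> g t = h t) \<Longrightarrow> \<Phi> g = \<Phi> h"
  by (rule \<Phi>_eqI[OF g calc_cong[OF calc_\<Phi>[OF h]]]) simp

lemma norm_\<Phi>: "(\<And>t. t \<in> {-1..1} \<Longrightarrow> cmod (g t) \<le> M) \<Longrightarrow> norm (\<Phi> g) \<le> 2 * M"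
  by (rule calc_norm[OF calc_\<Phi>[OF g]])

end

lemma jordan_U_\<Phi>:
  assumes g: "continuous_on {-1..1} g" and h: "continuous_on {-1..1} h"
  shows "jordan_U circ (\<Phi> g) (\<Phi> h) = \<Phi> (\<lambda>t. (g t)\<^sup>2 * h t)"
proof -
  have "(\<Phi> g \<odot> \<Phi> h) \<odot> \<Phi> g = \<Phi> (\<lambda>t. (g t * h t) * g t)" "(\<Phi> g \<odot> \<Phi> g) \<odot> \<Phi> h = \<Phi> (\<lambda>t. (g t * g t) * h t)"
    by (simp_all add: \<Phi>_mult g h continuous_on_mult)
  then show ?thesis
    by (simp add: jordan_U_def power2_eq_square mult_ac scaleR_2)
qed

text \<open>If \<open>g\<close> omits \<open>z\<close> on [-1, 1], then
  \<open>inverse (g t - z)\<close> is continuous there, and the calculus turns it into a Jordan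
  inverse.\<close>

lemma spectrum_\<Phi>:
  assumes g: "continuous_on {-1..1} g"
  shows "jordan_spectrum scaleC circ unit (\<Phi> g) \<subseteq> g ` {-1..1}"
proof
  fix z
  assume z: "z \<in> jordan_spectrum scaleC circ unit (\<Phi> g)"
  show "z \<in> g ` {-1..1}"
  proof (rule ccontr)
    assume "z \<notin> g ` {-1..1}"
    then have nz: "g t - z \<noteq> 0" if "t \<in> {-1..1}" for t
      using that by auto
    define k where "k t = g t - z" for t
    have k: "continuous_on {-1..1} k" "continuous_on {-1..1} (\<lambda>t. inverse (k t))"
      unfolding k_def using nz by (auto intro!: continuous_intros g)
    have "\<Phi> g - z *\<^sub>C unit = \<Phi> k"
      unfolding k_def using \<Phi>_diff[OF g continuous_on_const, of z] by (simp add: \<Phi>_const)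
    moreover have "\<Phi> k \<odot> \<Phi> (\<lambda>t. inverse (k t)) = \<Phi> (\<lambda>_. 1)"
      unfolding \<Phi>_mult[OF k, symmetric]
      using nz by (intro \<Phi>_cong continuous_intros k) (auto simp: k_def)
    moreover have "(\<Phi> k \<odot> \<Phi> k) \<odot> \<Phi> (\<lambda>t. inverse (k t)) = \<Phi> k"
      unfolding \<Phi>_mult[OF k(1,1), symmetric] \<Phi>_mult[OF continuous_on_mult[OF k(1,1)] k(2), symmetric]
      using nz by (intro \<Phi>_cong continuous_intros k) (auto simp: k_def)
    ultimately have "jordan_invertible circ unit (\<Phi> g - z *\<^sub>C unit)"
      unfolding jordan_invertible_def by (auto simp: \<Phi>_const)
    then show False
      using z by (simp add: jordan_spectrum_def)
  qed
qed

lemma tendsto_\<Phi>: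
  assumes G: "\<And>n. continuous_on {-1..1} (G n)" and g: "continuous_on {-1..1} g"
    and "uniform_limit {-1..1} G g sequentially"
  shows "(\<lambda>n. \<Phi> (G n)) \<longlonglongrightarrow> \<Phi> g"
proof (rule tendstoI)
  fix e :: real assume "0 < e"
  then have "\<forall>\<^sub>F n in sequentially. \<forall>t\<in>{-1..1}. dist (G n t) (g t) < e / 3"
    using uniform_limitD[OF assms(3), of "e / 3"] by simp
  then show "\<forall>\<^sub>F n in sequentially. dist (\<Phi> (G n)) (\<Phi> g) < e"
  proof eventually_elim
    case (elim n)
    then have "norm (\<Phi> (\<lambda>t. G n t - g t)) \<le> 2 * (e / 3)"
      by (intro norm_\<Phi> continuous_intros G g) (auto simp: dist_norm less_imp_le)
    then show ?case
      using \<open>0 < e\<close> by (simp add: \<Phi>_diff[OF G g] dist_norm)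
  qed
qed

end

section \<open>Spectral functionals on continuous functions over a compact set\<close>

lemma exp_dyadic_eq_1_imp_0:
  fixes w :: complex
  assumes "\<And>n. exp (w / 2 ^ n) = 1"
  shows "w = 0"
proof -
  \<comment> \<open>At this scale the imaginary part is a multiple of \<open>2 * pi\<close> of
    modulus below 1, hence 0.\<close>
  obtain n where n: "\<bar>Im w\<bar> < 2 ^ n"
    using real_arch_pow[of 2 "\<bar>Im w\<bar>"] by auto
  have "w / 2 ^ n = w / of_real (2 ^ n)"
    by simp
  then have eq: "Re (w / 2 ^ n) = Re w / 2 ^ n" "Im (w / 2 ^ n) = Im w / 2 ^ n"
    by (simp_all only: Re_divide_of_real Im_divide_of_real)
  obtain m :: int where m: "Re w = 0" "Im w / 2 ^ n = of_int (2 * m) * pi"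
    using assms[of n] unfolding exp_eq_1 eq by auto
  have "\<bar>of_int (2 * m) * pi\<bar> < 1"
    unfolding m(2)[symmetric] using n by (simp add: abs_divide)
  moreover have "1 \<le> \<bar>of_int (2 * m) * pi\<bar>" if "m \<noteq> 0"
  proof -
    have "1 \<le> \<bar>real_of_int (2 * m)\<bar>"
      using that by linarith
    then have "1 * 1 \<le> \<bar>real_of_int (2 * m)\<bar> * pi"
      using pi_ge_two by (intro mult_mono) auto
    then show ?thesis
      by (simp add: abs_mult)
  qed
  ultimately have "m = 0"
    by linarith
  with m show ?thesis
    by (simp add: complex_eq_iff)
qed

text \<open>
  Joint evaluation of \<open>k\<close> and \<open>l\<close> at a single point, read off from the complex function
  \<open>k + \<i>l\<close>, forces the point to be the same for all functions.
\<close>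

lemma spectral_functional_is_evaluation:
  fixes S :: "real set" and F :: "(real \<Rightarrow> complex) \<Rightarrow> complex"
  assumes S: "compact S"
    and mult: "\<And>g h. continuous_on S g \<Longrightarrow> continuous_on S h \<Longrightarrow> F (\<lambda>t. (g t)\<^sup>2 * h t) = (F g)\<^sup>2 * F h"
    and range: "\<And>g. continuous_on S g \<Longrightarrow> F g \<in> g ` S"
    and lim: "\<And>G g. (\<And>n. continuous_on S (G n)) \<Longrightarrow> continuous_on S g \<Longrightarrow>
      uniform_limit S G g sequentially \<Longrightarrow> (\<lambda>n. F (G n)) \<longlonglongrightarrow> F g"
  obtains t0 where
    "\<And>h. continuous_on S h \<Longrightarrow> (\<And>t. 0 \<le> h t) \<Longrightarrow> F (\<lambda>t. of_real (h t)) = of_real (h t0)"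
proof -
  have F1: "F (\<lambda>_. 1) = 1"
    using range[of "\<lambda>_. 1"] by auto
  have exp_half: "exp (z / 2) ^ 2 = exp z" for z :: complex
    by (simp add: exp_double[symmetric])
  have exp_double: "F (\<lambda>t. exp (k t)) = (F (\<lambda>t. exp (k t / 2)))\<^sup>2" if "continuous_on S k" for k
    using mult[of "\<lambda>t. exp (k t / 2)" "\<lambda>_. 1"] that by (simp add: F1 exp_half continuous_intros)
  \<comment> \<open>With \<open>exp (k t / 2)\<close> as the squared argument, the quadratic rule
    for \<open>F\<close> becomes multiplicativity on exponentials.\<close>
  have F_exp_add: "F (\<lambda>t. exp (k t + l t)) = F (\<lambda>t. exp (k t)) * F (\<lambda>t. exp (l t))"
    if "continuous_on S k" "continuous_on S l" for k l
    using mult[of "\<lambda>t. exp (k t / 2)" "\<lambda>t. exp (l t)"] that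
    by (simp add: exp_half exp_double[of k] exp_add continuous_intros)
  have dyadic: "F (\<lambda>t. exp (k t / 2 ^ n)) = F (\<lambda>t. exp (k t / 2 ^ (n + m))) ^ 2 ^ m"
    if "continuous_on S k" for k n m
  proof (induction m)
    case (Suc m)
    have "F (\<lambda>t. exp (k t / 2 ^ (n + m))) = (F (\<lambda>t. exp (k t / 2 ^ (n + Suc m))))\<^sup>2"
      using exp_double[of "\<lambda>t. k t / 2 ^ (n + m)"] that by (simp add: continuous_intros mult.commute)
    with Suc show ?case
      by (simp add: power_mult[symmetric])
  qed simp
  have evaluation: "\<exists>x. \<forall>n. F (\<lambda>t. exp (k t / 2 ^ n)) = exp (k x / 2 ^ n)"
    if k: "continuous_on S k" for k
  proof -
    have "continuous_on S (\<lambda>t. exp (k t / 2 ^ n))" for n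
      by (intro continuous_intros k) simp
    from range[OF this] have "\<exists>x\<in>S. F (\<lambda>t. exp (k t / 2 ^ n)) = exp (k x / 2 ^ n)" for n
      by (simp add: image_iff)
    then obtain X where X: "\<And>n. X n \<in> S" "\<And>n. F (\<lambda>t. exp (k t / 2 ^ n)) = exp (k (X n) / 2 ^ n)"
      by metis
    \<comment> \<open>Each scale \<open>n\<close> has its own point \<open>X n\<close>. Raising
      scale \<open>r j\<close> to a power of 2 recovers scale \<open>n\<close> whenever
      \<open>n \<le> j\<close>, so the points \<open>X (r j)\<close> eventually serve every fixed
      scale, and so does their limit \<open>x\<close>.\<close>
    obtain x r where r: "x \<in> S" "strict_mono r" "(X \<circ> r) \<longlonglongrightarrow> x"
      using S X(1) unfolding compact_def by metis
    have "F (\<lambda>t. exp (k t / 2 ^ n)) = exp (k x / 2 ^ n)" for n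
    proof -
      have "F (\<lambda>t. exp (k t / 2 ^ n)) = exp (k ((X \<circ> r) j) / 2 ^ n)" if nj: "n \<le> j" for j
      proof -
        obtain m where m: "r j = n + m"
          using order_trans[OF nj strict_mono_imp_increasing[OF r(2)]] le_iff_add by blast
        have "F (\<lambda>t. exp (k t / 2 ^ n)) = exp (of_nat (2 ^ m) * (k (X (r j)) / 2 ^ r j))"
          by (subst exp_of_nat_mult) (simp only: dyadic[OF k, of n m] m[symmetric] X(2))
        also have "of_nat (2 ^ m) * (k (X (r j)) / 2 ^ r j) = k (X (r j)) / 2 ^ n"
          by (simp add: m power_add)
        finally show ?thesis
          by simp
      qed
      then have "\<forall>\<^sub>F j in sequentially. F (\<lambda>t. exp (k t / 2 ^ n)) = exp (k ((X \<circ> r) j) / 2 ^ n)"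
        by (auto simp: eventually_sequentially)
      moreover have "(\<lambda>j. exp (k ((X \<circ> r) j) / 2 ^ n)) \<longlonglongrightarrow> exp (k x / 2 ^ n)"
        by (intro tendsto_intros continuous_on_tendsto_compose[OF k r(3,1)]) (use X in auto)
      ultimately have "(\<lambda>j. F (\<lambda>t. exp (k t / 2 ^ n))) \<longlonglongrightarrow> exp (k x / 2 ^ n)"
        by (simp add: tendsto_cong)
      then show ?thesis
        by (simp add: LIMSEQ_const_iff)
    qed
    then show ?thesis
      by blast
  qed
  have joint: "\<exists>x. (\<forall>n. F (\<lambda>t. exp (of_real (k t) / 2 ^ n)) = exp (of_real (k x) / 2 ^ n)) \<and>
      (\<forall>n. F (\<lambda>t. exp (\<i> * of_real (l t) / 2 ^ n)) = exp (\<i> * of_real (l x) / 2 ^ n))"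
    if kl: "continuous_on S k" "continuous_on S l" for k l :: "real \<Rightarrow> real"
  proof -
    have k: "continuous_on S (\<lambda>t. of_real (k t) :: complex)" and l: "continuous_on S (\<lambda>t. \<i> * of_real (l t))"
      by (intro continuous_intros kl)+
    obtain x where x: "\<And>n. F (\<lambda>t. exp ((of_real (k t) + \<i> * of_real (l t)) / 2 ^ n)) =
        exp ((of_real (k x) + \<i> * of_real (l x)) / 2 ^ n)"
      using evaluation[OF continuous_on_add[OF k l]] by auto
    obtain y where y: "\<And>n. F (\<lambda>t. exp (of_real (k t) / 2 ^ n)) = exp (of_real (k y) / 2 ^ n)"
      using evaluation[OF k] by auto
    obtain z where z: "\<And>n. F (\<lambda>t. exp (\<i> * of_real (l t) / 2 ^ n)) = exp (\<i> * of_real (l z) / 2 ^ n)"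
      using evaluation[OF l] by auto
    \<comment> \<open>Comparing exponents at all dyadic scales removes the ambiguity by multiples of
      \<open>2 * pi * \<i>\<close>. Since \<open>k\<close> and \<open>l\<close> are real, the two
      parts then separate, and \<open>x\<close> can replace both \<open>y\<close> and
      \<open>z\<close>.\<close>
    have "of_real (k x) + \<i> * of_real (l x) - (of_real (k y) + \<i> * of_real (l z)) = 0"
    proof (rule exp_dyadic_eq_1_imp_0)
      fix n
      have "exp ((of_real (k x) + \<i> * of_real (l x)) / 2 ^ n) =
          F (\<lambda>t. exp (of_real (k t) / 2 ^ n + \<i> * of_real (l t) / 2 ^ n))"
        using x[of n] by (simp only: add_divide_distrib)
      also have "\<dots> = F (\<lambda>t. exp (of_real (k t) / 2 ^ n)) * F (\<lambda>t. exp (\<i> * of_real (l t) / 2 ^ n))"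
        by (rule F_exp_add; intro continuous_intros kl; simp)
      also have "\<dots> = exp ((of_real (k y) + \<i> * of_real (l z)) / 2 ^ n)"
        by (simp only: y z add_divide_distrib exp_add)
      finally have "exp ((of_real (k x) + \<i> * of_real (l x)) / 2 ^ n) =
          exp ((of_real (k y) + \<i> * of_real (l z)) / 2 ^ n)" .
      then show "exp ((of_real (k x) + \<i> * of_real (l x) - (of_real (k y) + \<i> * of_real (l z))) / 2 ^ n) = 1"
        by (simp add: diff_divide_distrib exp_diff)
    qed
    then have "k x = k y" "l x = l z"
      by (auto simp: complex_eq_iff)
    then show ?thesis
      using y z by metis
  qed
  \<comment> \<open>The identity function detects the evaluation point: pairing it with any
    \<open>l\<close> will return this same \<open>t0\<close>.\<close>
  obtain t0 where t0: "\<And>n. F (\<lambda>t. exp (of_real t / 2 ^ n)) = exp (of_real t0 / 2 ^ n)"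
    using joint[of "\<lambda>t. t" "\<lambda>t. t"] by auto
  have F_exp: "F (\<lambda>t. exp (of_real (l t))) = exp (of_real (l t0))" if l: "continuous_on S l" for l
  proof -
    obtain x where x: "\<And>n. F (\<lambda>t. exp (of_real t / 2 ^ n)) = exp (of_real x / 2 ^ n)"
      "\<And>n. F (\<lambda>t. exp (\<i> * of_real (l t) / 2 ^ n)) = exp (\<i> * of_real (l x) / 2 ^ n)"
      using joint[OF continuous_on_id l] by auto
    have "exp (of_real x) = (exp (of_real t0) :: complex)"
      using x(1)[of 0] t0[of 0] by simp
    then have "x = t0"
      by (simp only: exp_of_real of_real_eq_iff exp_inj_iff)
    \<comment> \<open>The pairing with the identity settles \<open>\<i> * l\<close> at
      \<open>t0\<close>; pairing \<open>l\<close> with itself transfers this to the real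
      exponent.\<close>
    obtain y where y: "\<And>n. F (\<lambda>t. exp (of_real (l t) / 2 ^ n)) = exp (of_real (l y) / 2 ^ n)"
      "\<And>n. F (\<lambda>t. exp (\<i> * of_real (l t) / 2 ^ n)) = exp (\<i> * of_real (l y) / 2 ^ n)"
      using joint[OF l l] by auto
    have "\<i> * of_real (l y) - \<i> * of_real (l t0) = 0"
    proof (rule exp_dyadic_eq_1_imp_0)
      fix n
      have "exp (\<i> * of_real (l y) / 2 ^ n) = exp (\<i> * of_real (l t0) / 2 ^ n)"
        using x(2)[of n] y(2)[of n] \<open>x = t0\<close> by (simp only:)
      then show "exp ((\<i> * of_real (l y) - \<i> * of_real (l t0)) / 2 ^ n) = 1"
        by (simp add: diff_divide_distrib exp_diff)
    qed
    then have "l y = l t0"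
      by simp
    then show ?thesis
      using y(1)[of 0] by simp
  qed
  show ?thesis
  proof (rule that)
    fix h :: "real \<Rightarrow> real"
    assume h: "continuous_on S h" "\<And>t. 0 \<le> h t"
    \<comment> \<open>The shift makes \<open>h\<close> strictly positive, hence the exponential of a
      continuous real function; \<open>lim\<close> then removes it.\<close>
    define G where "G n t = (of_real (h t + inverse (real (Suc n))) :: complex)" for n t
    have pos: "0 < h t + inverse (real (Suc n))" for n t
      using h(2)[of t] by (simp add: add_nonneg_pos)
    then have "G n = (\<lambda>t. exp (of_real (ln (h t + inverse (real (Suc n))))))" for n
      unfolding G_def by (simp add: exp_of_real)
    moreover have "continuous_on S (\<lambda>t. ln (h t + inverse (real (Suc n))))" for n
      using pos by (intro continuous_intros h) (auto simp: less_imp_neq[symmetric])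
    ultimately have FG: "F (G n) = G n t0" for n
      using F_exp by simp
    have "uniform_limit S G (\<lambda>t. of_real (h t)) sequentially"
    proof (rule uniform_limitI)
      fix e :: real assume "0 < e"
      then have "\<forall>\<^sub>F n in sequentially. inverse (real (Suc n)) < e"
        using LIMSEQ_inverse_real_of_nat by (rule order_tendstoD(2)[rotated])
      then show "\<forall>\<^sub>F n in sequentially. \<forall>t\<in>S. dist (G n t) (of_real (h t)) < e"
        by eventually_elim (simp only: G_def dist_of_real, simp add: dist_real_def)
    qed
    then have "(\<lambda>n. F (G n)) \<longlonglongrightarrow> F (\<lambda>t. of_real (h t))"
      unfolding G_def by (intro lim continuous_intros h)
    moreover have "(\<lambda>n. G n t0) \<longlonglongrightarrow> of_real (h t0 + 0)"
      unfolding G_def by (intro tendsto_intros LIMSEQ_inverse_real_of_nat)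
    ultimately show "F (\<lambda>t. of_real (h t)) = of_real (h t0)"
      unfolding FG using LIMSEQ_unique by fastforce
  qed
qed

section \<open>Localization of \<open>f\<close>, its additivity and its multiplicativity\<close>

locale spectral_U_multiplicative = unital_jb_star_algebra +
  fixes f :: "'a \<Rightarrow> complex"
  assumes cont: "continuous_on UNIV f"
    and f_U: "f (jordan_U circ x y) = (f x)\<^sup>2 * f y"
    and f_spectrum: "f x \<in> jordan_spectrum scaleC circ unit x"
begin

lemma tendsto_f: "X \<longlonglongrightarrow> x \<Longrightarrow> (\<lambda>n. f (X n)) \<longlonglongrightarrow> f x"
  using continuous_on_tendsto_compose[OF cont] by simp

text \<open>Nonzero multiples of \<open>unit\<close> are invertible, which leaves \<open>z\<close>
  as the only possible spectral value.\<close>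

lemma f_scaleC_unit: "f (z *\<^sub>C unit) = z"
proof (rule ccontr)
  define w where "w = z - f (z *\<^sub>C unit)"
  assume "f (z *\<^sub>C unit) \<noteq> z"
  then have "w \<noteq> 0"
    by (simp add: w_def)
  then have "jordan_invertible circ unit (w *\<^sub>C unit)"
    unfolding jordan_invertible_def
    by (intro exI[of _ "inverse w *\<^sub>C unit"]) (simp add: circ_scaleC_left circ_scaleC_right unit_circ)
  then show False
    using f_spectrum[of "z *\<^sub>C unit"] by (simp add: jordan_spectrum_def w_def scale_left_diff_distrib)
qed

text \<open>The U-operator of \<open>csqrt z\<close> times \<open>unit\<close> is multiplication by
  \<open>z\<close>, so homogeneity is an instance of \<open>f_U\<close>.\<close>

lemma f_scaleC: "f (z *\<^sub>C x) = z * f x"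
proof -
  have "jordan_U circ (csqrt z *\<^sub>C unit) x = (csqrt z * csqrt z) *\<^sub>C x"
    by (simp add: jordan_U_def circ_scaleC_left circ_scaleC_right unit_circ circ_unit scaleR_2)
  then show ?thesis
    using f_U[of "csqrt z *\<^sub>C unit" x] by (simp add: f_scaleC_unit power2_eq_square[symmetric])
qed

lemma jordan_U_add: "jordan_U circ h (x + y) = jordan_U circ h x + jordan_U circ h y"
  by (simp add: jordan_U_def circ.add_left circ.add_right scaleR_add_right)

lemma jordan_U_scaleR: "jordan_U circ h (r *\<^sub>R x) = r *\<^sub>R jordan_U circ h x"
  by (simp add: jordan_U_def circ.scaleR_left circ.scaleR_right scaleR_diff_right)

text \<open>
  The element \<open>h\<close> is a bump at \<open>\<alpha>\<close> applied to \<open>c\<close>, and \<open>b\<close> is \<open>c - \<alpha>\<close> clipped to \<open>[-e, e]\<close>.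
\<close>

lemma localization_small:
  assumes "star c = c" "norm c \<le> 1 / 2"
  obtains \<alpha> :: real where "\<And>e. 0 < e \<Longrightarrow> \<exists>h b. f h = 1 \<and> norm b \<le> 2 * e \<and>
    jordan_U circ h c = jordan_U circ h (of_real \<alpha> *\<^sub>C unit + b)"
proof -
  interpret small_self_adjoint scaleC circ star unit c
    by unfold_locales (fact assms)+
  obtain t0 where t0: "\<And>h. continuous_on {-1..1} h \<Longrightarrow> (\<And>t. 0 \<le> h t) \<Longrightarrow>
      f (\<Phi> (\<lambda>t. of_real (h t))) = of_real (h t0)"
  proof (rule spectral_functional_is_evaluation[of "{-1..1}" "\<lambda>g. f (\<Phi> g)"])
    show "f (\<Phi> (\<lambda>t. (g t)\<^sup>2 * h t)) = (f (\<Phi> g))\<^sup>2 * f (\<Phi> h)"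
      if "continuous_on {-1..1} g" "continuous_on {-1..1} h" for g h
      using that by (simp add: jordan_U_\<Phi>[symmetric] f_U)
    show "f (\<Phi> g) \<in> g ` {-1..1}" if "continuous_on {-1..1} g" for g
      using spectrum_\<Phi>[OF that] f_spectrum by blast
    show "(\<lambda>n. f (\<Phi> (G n))) \<longlonglongrightarrow> f (\<Phi> g)"
      if "\<And>n. continuous_on {-1..1} (G n)" "continuous_on {-1..1} g"
        "uniform_limit {-1..1} G g sequentially" for G g
      using that by (intro tendsto_f tendsto_\<Phi>)
  qed auto
  show ?thesis
  proof (rule that)
    fix e :: real assume e: "0 < e"
    define h where "h t = max 0 (1 - \<bar>t - t0\<bar> / e)" for t
    define k where "k t = max (- e) (min e (t - t0))" for t
    have ch: "continuous_on {-1..1} (\<lambda>t. of_real (h t) :: complex)"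
      and ck: "continuous_on {-1..1} (\<lambda>t. of_real (k t) :: complex)"
      unfolding h_def k_def by (intro continuous_intros; use e in simp)+
    \<comment> \<open>Clipping changes \<open>t - t0\<close> only where the tent \<open>h\<close>
      vanishes, and the U-operator of \<open>H\<close> multiplies by the square of
      \<open>h\<close>.\<close>
    have clip: "(h t)\<^sup>2 * (t - t0) = (h t)\<^sup>2 * k t" for t
    proof (cases "\<bar>t - t0\<bar> \<le> e")
      case True
      then show ?thesis
        by (auto simp: k_def)
    next
      case False
      then have "h t = 0"
        using e by (simp add: h_def)
      then show ?thesis
        by simp
    qed
    define H where "H = \<Phi> (\<lambda>t. of_real (h t))"
    define B where "B = \<Phi> (\<lambda>t. of_real (k t))"
    have "c = of_real t0 *\<^sub>C unit + \<Phi> (\<lambda>t. of_real t - of_real t0)"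
      using \<Phi>_diff[of of_real "\<lambda>_. of_real t0"] by (simp add: \<Phi>_of_real \<Phi>_const continuous_intros)
    moreover have "jordan_U circ H (\<Phi> (\<lambda>t. of_real t - of_real t0)) = jordan_U circ H B"
    proof -
      have "(\<lambda>t. (of_real (h t))\<^sup>2 * (of_real t - of_real t0)) = (\<lambda>t. (of_real (h t))\<^sup>2 * of_real (k t) :: complex)"
        by (simp only: of_real_power[symmetric] of_real_diff[symmetric] of_real_mult[symmetric] clip)
      moreover have "continuous_on {-1..1} (\<lambda>t. of_real t - of_real t0 :: complex)"
        by (intro continuous_intros)
      ultimately show ?thesis
        unfolding H_def B_def by (simp only: jordan_U_\<Phi>[OF ch] ck)
    qed
    ultimately have "jordan_U circ H c = jordan_U circ H (of_real t0 *\<^sub>C unit + B)"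
      by (metis jordan_U_add)
    moreover have "f H = 1"
      unfolding H_def using t0[of h] e by (simp add: h_def continuous_intros)
    moreover have "norm B \<le> 2 * e"
      unfolding B_def by (rule norm_\<Phi>[OF ck]) (use e in \<open>auto simp: k_def\<close>)
    ultimately show "\<exists>h b. f h = 1 \<and> norm b \<le> 2 * e \<and>
        jordan_U circ h c = jordan_U circ h (of_real t0 *\<^sub>C unit + b)"
      by blast
  qed
qed

text \<open>The scalar from \<open>localization_small\<close> is fixed before \<open>y\<close> and
  before the width \<open>e\<close>, so it works for all \<open>y\<close>, and continuity of
  \<open>f\<close> lets the error \<open>b\<close> tend to 0.\<close>

lemma f_add_self_adjoint:
  assumes "star a = a"
  obtains \<alpha> where "\<And>y. f (y + a) = f (y + \<alpha> *\<^sub>C unit)"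
proof -
  \<comment> \<open>Dividing by \<open>r\<close> brings the norm to at most 1/2, as localization
    requires; the summand 1 keeps \<open>r\<close> positive when \<open>a = 0\<close>.\<close>
  define r where "r = 2 * norm a + 1"
  have r: "0 < r"
    by (simp add: r_def add_nonneg_pos)
  define c where "c = inverse r *\<^sub>R a"
  have "norm c \<le> 1 / 2"
    using r by (simp add: c_def r_def field_simps)
  moreover have "star c = c"
    by (simp add: c_def star_scaleR assms)
  ultimately obtain \<alpha> :: real where \<alpha>: "\<And>e. 0 < e \<Longrightarrow> \<exists>h b. f h = 1 \<and> norm b \<le> 2 * e \<and>
      jordan_U circ h c = jordan_U circ h (of_real \<alpha> *\<^sub>C unit + b)"
    using localization_small by blast
  have a: "a = r *\<^sub>R c"
    using r by (simp add: c_def)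
  show ?thesis
  proof (rule that)
    fix y
    have "\<exists>b. norm b \<le> 2 * inverse (real (Suc n)) \<and>
      f (y + a) = f (y + r *\<^sub>R (of_real \<alpha> *\<^sub>C unit + b))" for n
    proof -
      obtain h b where h: "f h = 1" "norm b \<le> 2 * inverse (real (Suc n))"
        "jordan_U circ h c = jordan_U circ h (of_real \<alpha> *\<^sub>C unit + b)"
        using \<alpha>[of "inverse (real (Suc n))"] by auto
      have "f (y + a) = f (jordan_U circ h (y + a))"
        by (simp add: f_U h)
      also have "jordan_U circ h (y + a) = jordan_U circ h (y + r *\<^sub>R (of_real \<alpha> *\<^sub>C unit + b))"
        by (simp only: a jordan_U_add[of h y] jordan_U_scaleR h(3))
      also have "f \<dots> = f (y + r *\<^sub>R (of_real \<alpha> *\<^sub>C unit + b))"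
        by (simp add: f_U h)
      finally show ?thesis
        using h(2) by blast
    qed
    then obtain b where b: "\<And>n. norm (b n) \<le> 2 * inverse (real (Suc n))"
      "\<And>n. f (y + a) = f (y + r *\<^sub>R (of_real \<alpha> *\<^sub>C unit + b n))"
      by metis
    have "(\<lambda>n. 2 * inverse (real (Suc n))) \<longlonglongrightarrow> 0"
      by (rule tendsto_mult_right_zero[OF LIMSEQ_inverse_real_of_nat])
    then have "b \<longlonglongrightarrow> 0"
      by (rule Lim_null_comparison[OF always_eventually, rotated]) (use b(1) in blast)
    then have "(\<lambda>n. f (y + r *\<^sub>R (of_real \<alpha> *\<^sub>C unit + b n))) \<longlonglongrightarrow> f (y + r *\<^sub>R (of_real \<alpha> *\<^sub>C unit + 0))"
      by (intro tendsto_f tendsto_intros)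
    then have "f (y + a) = f (y + r *\<^sub>R (of_real \<alpha> *\<^sub>C unit + 0))"
      unfolding b(2)[symmetric] by (simp add: LIMSEQ_const_iff)
    then show "f (y + a) = f (y + of_real (r * \<alpha>) *\<^sub>C unit)"
      by (simp add: scaleC_of_real del: of_real_mult)
  qed
qed

text \<open>With \<open>x = a + \<i> *\<^sub>C b\<close> split into self-adjoint parts, homogeneity
  of \<open>f\<close> moves the factor \<open>\<i>\<close> off \<open>b\<close>, so that the
  self-adjoint case applies to both parts in turn.\<close>

lemma f_add_scalar:
  obtains \<gamma> where "\<And>y. f (y + x) = f (y + \<gamma> *\<^sub>C unit)"
proof -
  define a where "a = (1 / 2 :: real) *\<^sub>R (x + star x)"
  define b where "b = (- \<i> / 2) *\<^sub>C (x - star x)"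
  have "star a = a" "star b = b"
    by (simp_all add: a_def b_def star_scaleR star_scaleC star_add star.diff star_star add.commute
        scale_right_diff_distrib)
  then obtain \<alpha> \<beta> where \<alpha>: "\<And>y. f (y + a) = f (y + \<alpha> *\<^sub>C unit)" and \<beta>: "\<And>y. f (y + b) = f (y + \<beta> *\<^sub>C unit)"
    by (metis f_add_self_adjoint)
  have x: "x = a + \<i> *\<^sub>C b"
  proof -
    have "\<i> *\<^sub>C b = (1 / 2 :: real) *\<^sub>R (x - star x)"
      by (simp add: b_def scaleC_of_real[symmetric])
    then show ?thesis
      by (simp add: a_def scaleR_add_right[symmetric])
  qed
  have i: "f (y + \<i> *\<^sub>C z) = \<i> * f ((- \<i>) *\<^sub>C y + z)" for y z
    by (subst f_scaleC[symmetric]) (simp add: scale_right_distrib scale_right_diff_distrib add.commute)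
  show ?thesis
  proof (rule that)
    fix y
    have "f (y + x) = f ((y + a) + \<i> *\<^sub>C b)"
      by (simp add: x add.assoc)
    also have "\<dots> = f ((y + a) + \<i> *\<^sub>C (\<beta> *\<^sub>C unit))"
      by (simp only: i \<beta>)
    also have "\<dots> = f ((y + (\<i> * \<beta>) *\<^sub>C unit) + a)"
      by (simp add: add_ac)
    also have "\<dots> = f (y + (\<i> * \<beta> + \<alpha>) *\<^sub>C unit)"
      unfolding \<alpha> by (simp add: scale_left_distrib add_ac)
    finally show "f (y + x) = f (y + (\<i> * \<beta> + \<alpha>) *\<^sub>C unit)" .
  qed
qed

text \<open>The summands are exchanged for scalars one after the other, and \<open>f\<close> is the
  identity on scalars. Taking \<open>z = 0\<close> identifies these scalars as \<open>f x\<close>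
  and \<open>f y\<close>.\<close>

lemma f_add: "f (x + y) = f x + f y"
proof -
  obtain \<gamma> \<delta> where \<gamma>: "\<And>z. f (z + x) = f (z + \<gamma> *\<^sub>C unit)" and \<delta>: "\<And>z. f (z + y) = f (z + \<delta> *\<^sub>C unit)"
    by (metis f_add_scalar)
  have "f x = \<gamma>" "f y = \<delta>"
    using \<gamma>[of 0] \<delta>[of 0] by (simp_all add: f_scaleC_unit)
  moreover have "f (x + y) = f (\<delta> *\<^sub>C unit + x)"
    unfolding \<delta> by (simp add: add.commute)
  then have "f (x + y) = f ((\<delta> + \<gamma>) *\<^sub>C unit)"
    by (simp add: \<gamma> scale_left_distrib)
  ultimately show ?thesis
    by (simp add: f_scaleC_unit)
qed

lemma f_circ: "f (x \<odot> y) = f x * f y"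
proof -
  have "jordan_U circ z unit = z \<odot> z" for z
    by (simp add: jordan_U_def circ_unit scaleR_2)
  then have sq: "f (z \<odot> z) = (f z)\<^sup>2" for z
    using f_U[of z unit] f_scaleC_unit[of 1] by simp
  have "f ((x + y) \<odot> (x + y)) = f (x \<odot> x) + 2 * f (x \<odot> y) + f (y \<odot> y)"
    by (simp add: circ.add_left circ.add_right f_add circ_commute[of y x])
  then show ?thesis
    unfolding sq f_add by (simp add: power2_eq_square algebra_simps)
qed

lemma linear_f: "Vector_Spaces.linear scaleC (*) f"
  by unfold_locales (simp_all add: f_add f_scaleC algebra_simps)

end

theorem theorem4p3:
  fixes scaleC :: "complex \<Rightarrow> 'a::banach \<Rightarrow> 'a"
    and circ :: "'a \<Rightarrow> 'a \<Rightarrow> 'a"  (infixl \<open>\<odot>\<close> 70)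
    and star :: "'a \<Rightarrow> 'a"
    and unit :: 'a
    and f :: "'a \<Rightarrow> complex"
  assumes "unital_jb_star_algebra scaleC circ star unit"
    and "continuous_on UNIV f"
    and "\<And>x y. f (jordan_U circ x y) = jordan_U (*) (f x) (f y)"
    and "\<And>x. f x \<in> jordan_spectrum scaleC circ unit x"
  shows "Vector_Spaces.linear scaleC (*) f \<and> (\<forall>x y. f (x \<odot> y) = f x * f y)"
proof -
  interpret spectral_U_multiplicative scaleC circ star unit f
    using assms by (simp add: spectral_U_multiplicative_def spectral_U_multiplicative_axioms_def jordan_U_complex)
  show ?thesis
    using linear_f f_circ by blast
qed

end
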